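(* Let $X\in\mathbb{R}^{n\times N_1}$, $Y\in\mathbb{R}^{m\times N_1}$, $U\in\mathbb{R}^{m\times N_2}$, $V\in\mathbb{R}^{n\times N_2}$, and $L\ge 0$. There exists a matrix $M\in\mathbb{R}^{m\times n}$ with $\sigma_{\max}(M)\le L$ such that $Y=MX$ and $V=M^TU$ if, and only if, $$\begin{cases} X^TV=Y^TU,\\ Y^TY\preceq L^2X^TX,\\ V^TV\preceq L^2U^TU.\end{cases}$$ Moreover, if $U=X$ and $V=Y$ (resp. $V=-Y$), in particular $m=n$ and $N_1=N_2$, then, whenever these conditions hold, the interpolating matrix $M$ can be chosen symmetric (resp. skew-symmetric).
   Context: All matrices are real. $\sigma_{\max}(M)$ denotes the largest singular value of $M$, and $\preceq$ denotes the Löwner order on symmetric matrices ($A\preceq B$ iff $B-A$ is positive semidefinite). *)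

theory Defs
  imports "HOL-Analysis.Analysis"
begin

text \<open>A matrix with \<open>r\<close> rows and \<open>c\<close> columns has type \<open>real ^ 'c ^ 'r\<close>; the library lists
  the column index first.\<close>

definition eigenvalue :: "real ^ 'n ^ 'n \<Rightarrow> real \<Rightarrow> bool" where
  "eigenvalue A k \<longleftrightarrow> (\<exists>v. v \<noteq> 0 \<and> A *v v = k *\<^sub>R v)"

text \<open>For an \<open>m \<times> n\<close> matrix with \<open>n > m\<close>, this set may contain a \<open>0\<close> coming from the kernel of
  \<open>M\<^sup>T M\<close> that is not among the \<open>min m n\<close> conventional singular values. Its largest
  element is the same under both conventions.\<close>

definition singular_values :: "real ^ 'n ^ 'm \<Rightarrow> real set" where
  "singular_values M = {sqrt k | k. eigenvalue (transpose M ** M) k}"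

definition sigma_max :: "real ^ 'n ^ 'm \<Rightarrow> real" where
  "sigma_max M = Max (singular_values M)"

definition symmetric_matrix :: "real ^ 'n ^ 'n \<Rightarrow> bool" where
  "symmetric_matrix A \<longleftrightarrow> transpose A = A"

definition skew_symmetric_matrix :: "real ^ 'n ^ 'n \<Rightarrow> bool" where
  "skew_symmetric_matrix A \<longleftrightarrow> transpose A = - A"

definition pos_semidef :: "real ^ 'n ^ 'n \<Rightarrow> bool" where
  "pos_semidef A \<longleftrightarrow> symmetric_matrix A \<and> (\<forall>x. 0 \<le> x \<bullet> (A *v x))"

definition loewner_le :: "real ^ 'n ^ 'n \<Rightarrow> real ^ 'n ^ 'n \<Rightarrow> bool"  (infix "\<preceq>" 50) where
  "A \<preceq> B \<longleftrightarrow> pos_semidef (B - A)"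

definition interpolates ::
  "real \<Rightarrow> real ^ 'p ^ 'n \<Rightarrow> real ^ 'p ^ 'm \<Rightarrow> real ^ 'q ^ 'm \<Rightarrow> real ^ 'q ^ 'n \<Rightarrow> real ^ 'n ^ 'm \<Rightarrow> bool"
  where
  "interpolates L X Y U V M \<longleftrightarrow> sigma_max M \<le> L \<and> Y = M ** X \<and> V = transpose M ** U"

definition interpolation_conditions ::
  "real \<Rightarrow> real ^ 'p ^ 'n \<Rightarrow> real ^ 'p ^ 'm \<Rightarrow> real ^ 'q ^ 'm \<Rightarrow> real ^ 'q ^ 'n \<Rightarrow> bool"
  where
  "interpolation_conditions L X Y U V \<longleftrightarrow>
     transpose X ** V = transpose Y ** U \<and>
     transpose Y ** Y \<preceq> L\<^sup>2 *\<^sub>R (transpose X ** X) \<and>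
     transpose V ** V \<preceq> L\<^sup>2 *\<^sub>R (transpose U ** U)"

end

theory Submission
  imports Defs
begin

text \<open>After the shift \<open>W = Y + L X\<close>, a partially defined symmetric operator \<open>X a \<mapsto> Y a\<close> of norm at
  most \<open>L\<close> becomes a nonnegative one with \<open>|W a|\<^sup>2 \<le> 2 L \<langle>a, K a\<rangle>\<close>, where \<open>K = X\<^sup>T W\<close>. Krein's smallest
  nonnegative extension \<open>G = W K\<^sup>+ W\<^sup>T\<close> satisfies \<open>|G h|\<^sup>2 \<le> 2 L \<langle>G h, h\<rangle>\<close>, which says precisely that
  \<open>G - L\<close> has norm at most \<open>L\<close>. The two-sided interpolation problem is the symmetric problem for
  the operator \<open>(x, u) \<mapsto> (M\<^sup>T u, M x)\<close>, and the (skew-)symmetric variants follow by averaging \<open>M\<close> with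
  \<open>\<plusminus> M\<^sup>T\<close>.\<close>

section \<open>The largest singular value\<close>

text \<open>If \<open>f x\<close> were nonzero, a short step from \<open>x\<close> along
  \<open>- f x\<close> would make the quadratic form negative: the gain is of first order in the
  step, the cost of second order.\<close>

lemma psd_zero_imp_kernel:
  fixes f :: "'a::real_inner \<Rightarrow> 'a"
  assumes "linear f" and sym: "\<And>x y. f x \<bullet> y = x \<bullet> f y"
    and nonneg: "\<And>x. 0 \<le> x \<bullet> f x" and bound: "\<And>x. x \<bullet> f x \<le> k * (x \<bullet> x)"
    and "0 \<le> k" and null: "x \<bullet> f x = 0"
  shows "f x = 0"
proof -
  interpret linear f by fact
  \<comment> \<open>Using \<open>k + 1\<close> keeps \<open>s\<close> defined at
    \<open>k = 0\<close>; \<open>s * k \<le> 1\<close> makes the factor \<open>s * k - 2\<close>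
    below negative.\<close>
  define c s where "c = f x \<bullet> f x" and "s = 1 / (k + 1)"
  have s: "0 < s" "s * k \<le> 1"
    using \<open>0 \<le> k\<close> by (auto simp: s_def field_simps)
  have "0 \<le> (x - s *\<^sub>R f x) \<bullet> f (x - s *\<^sub>R f x)"
    by (rule nonneg)
  also have "\<dots> = s * (s * (f x \<bullet> f (f x))) - 2 * s * c"
    unfolding diff scale inner_diff_left inner_diff_right inner_scaleR_left inner_scaleR_right
      null sym[of x "f x", symmetric] c_def
    by (simp add: algebra_simps)
  also have "\<dots> \<le> s * (s * (k * c)) - 2 * s * c"
    using bound[of "f x"] s by (simp add: c_def)
  also have "\<dots> = s * c * (s * k - 2)"
    by (simp add: algebra_simps)
  finally have "0 \<le> s * c * (s * k - 2)" .
  moreover have "0 \<le> c"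
    by (simp add: c_def)
  ultimately have "c = 0"
    using s by (smt (verit) mult_pos_neg mult_pos_pos)
  then show ?thesis
    by (simp add: c_def)
qed

lemma inner_gram_mult:
  fixes A :: "real ^ 'n ^ 'm" and B :: "real ^ 'p ^ 'm"
  shows "x \<bullet> ((transpose A ** B) *v y) = (A *v x) \<bullet> (B *v y)"
  by (metis dot_lmul_matrix matrix_vector_mul_assoc transpose_matrix_vector
      vector_transpose_matrix)

text \<open>Makes the \<open>Max\<close> in \<open>sigma_max\<close> meaningful. Eigenvectors of a
  symmetric matrix for distinct eigenvalues are orthogonal, hence independent, hence finitely
  many.\<close>

lemma finite_singular_values: "finite (singular_values (M :: real ^ 'n ^ 'm))"
proof -
  define A where "A = transpose M ** M"
  define E where "E = {k. eigenvalue A k}"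
  have "\<forall>k\<in>E. \<exists>v. v \<noteq> 0 \<and> A *v v = k *\<^sub>R v"
    by (auto simp: E_def eigenvalue_def)
  then obtain v where v: "\<And>k. k \<in> E \<Longrightarrow> v k \<noteq> 0" "\<And>k. k \<in> E \<Longrightarrow> A *v v k = k *\<^sub>R v k"
    by metis
  have sym: "x \<bullet> (A *v y) = (A *v x) \<bullet> y" for x y
    unfolding A_def by (metis inner_commute inner_gram_mult)
  have orth: "v k \<bullet> v l = 0" if "k \<in> E" "l \<in> E" "k \<noteq> l" for k l
    using sym[of "v k" "v l"] v that by simp
  have "inj_on v E"
    by (rule inj_onI) (metis inner_eq_zero_iff orth v(1))
  moreover have "pairwise orthogonal (v ` E)"
    by (auto simp: pairwise_def orthogonal_def intro!: orth)
  then have "finite (v ` E)"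
    using v(1) pairwise_orthogonal_independent independent_imp_finite
    by (metis image_iff)
  ultimately have "finite E"
    by (blast dest: finite_imageD)
  moreover have "singular_values M = sqrt ` E"
    by (auto simp: singular_values_def E_def A_def)
  ultimately show ?thesis
    by simp
qed

text \<open>The operator norm is itself a singular value: compactness of the sphere yields a
  maximizer, which is an eigenvector of \<open>transpose M ** M\<close>.\<close>

lemma norm_bound_attained:
  fixes M :: "real ^ 'n ^ 'm"
  obtains s where "s \<in> singular_values M" "0 \<le> s" "\<And>x. norm (M *v x) \<le> s * norm x"
proof -
  have "compact (sphere (0 :: real ^ 'n) 1)" "sphere (0 :: real ^ 'n) 1 \<noteq> {}"
    by simp_all
  moreover have "continuous_on (sphere 0 1) (\<lambda>x. norm (M *v x))"
    by (intro continuous_intros linear_continuous_on matrix_vector_mul_bounded_linear)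
  ultimately obtain x0 where x0: "norm x0 = 1"
    and max: "\<And>x. norm x = 1 \<Longrightarrow> norm (M *v x) \<le> norm (M *v x0)"
    using continuous_attains_sup[of "sphere (0 :: real ^ 'n) 1" "\<lambda>x. norm (M *v x)"] by auto
  define s where "s = norm (M *v x0)"
  have bound: "norm (M *v x) \<le> s * norm x" for x
  proof (cases "x = 0")
    case False
    have "norm (M *v (x /\<^sub>R norm x)) \<le> s"
      unfolding s_def by (rule max) (use False in simp)
    moreover have "M *v (x /\<^sub>R norm x) = (M *v x) /\<^sub>R norm x"
      by (rule linear_cmul) simp
    ultimately show ?thesis
      using False by (simp add: field_simps)
  qed simp
  \<comment> \<open>The form of \<open>f\<close> is nonnegative by \<open>bound\<close> and vanishes
    at \<open>x0\<close>, which forces \<open>x0\<close> into the kernel of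
    \<open>f\<close>.\<close>
  define f where "f x = s\<^sup>2 *\<^sub>R x - (transpose M ** M) *v x" for x
  have inner_f: "x \<bullet> f y = s\<^sup>2 * (x \<bullet> y) - (M *v x) \<bullet> (M *v y)" for x y
    by (simp add: f_def inner_diff_right inner_gram_mult)
  have "f x0 = 0"
  proof (rule psd_zero_imp_kernel[of f "s\<^sup>2"])
    show "linear f"
      unfolding f_def[abs_def]
      by (intro linear_compose_sub linear_scaleR matrix_vector_mul_linear)
    show "f x \<bullet> y = x \<bullet> f y" for x y
      by (simp add: inner_f inner_commute[of "f x"] inner_commute[of y] inner_commute[of "M *v y"])
    show "0 \<le> x \<bullet> f x" for x
      using power_mono[OF bound[of x], of 2]
      by (simp add: inner_f power_mult_distrib flip: power2_norm_eq_inner)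
    show "x \<bullet> f x \<le> s\<^sup>2 * (x \<bullet> x)" for x
      by (simp add: inner_f)
    show "x0 \<bullet> f x0 = 0"
      using x0 by (simp add: inner_f s_def flip: power2_norm_eq_inner)
  qed simp
  then have "eigenvalue (transpose M ** M) (s\<^sup>2)"
    using x0 by (auto simp: eigenvalue_def f_def intro!: exI[of _ x0])
  then have "s \<in> singular_values M"
    unfolding singular_values_def by (force simp: s_def)
  then show ?thesis
    using that bound by (simp add: s_def)
qed

text \<open>Replaces \<open>Max\<close> by an operator bound from here on. One direction uses that
  the best bound is a singular value, the other that an eigenvector \<open>v\<close> for
  \<open>k\<close> satisfies \<open>k |v|^2 = |M v|^2\<close>.\<close>

lemma sigma_max_le_iff:
  fixes M :: "real ^ 'n ^ 'm"
  assumes "0 \<le> L"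
  shows "sigma_max M \<le> L \<longleftrightarrow> (\<forall>x. norm (M *v x) \<le> L * norm x)"
proof
  assume le: "sigma_max M \<le> L"
  obtain s where "s \<in> singular_values M" and s: "\<And>x. norm (M *v x) \<le> s * norm x"
    using norm_bound_attained by blast
  then have "s \<le> L"
    using le Max_ge[OF finite_singular_values, of s M] by (simp add: sigma_max_def)
  then show "\<forall>x. norm (M *v x) \<le> L * norm x"
    using s by (meson mult_right_mono norm_ge_zero order_trans)
next
  assume bound: "\<forall>x. norm (M *v x) \<le> L * norm x"
  have "t \<le> L" if t: "t \<in> singular_values M" for t
  proof -
    obtain k v where "t = sqrt k" "v \<noteq> 0" and v: "(transpose M ** M) *v v = k *\<^sub>R v"
      using t by (auto simp: singular_values_def eigenvalue_def)
    have "k * (norm v)\<^sup>2 = (norm (M *v v))\<^sup>2"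
      using inner_gram_mult[of v M M v] v by (simp add: power2_norm_eq_inner)
    also have "\<dots> \<le> L\<^sup>2 * (norm v)\<^sup>2"
      using power_mono[of "norm (M *v v)" "L * norm v" 2] bound
      by (simp add: power_mult_distrib)
    finally have "k \<le> L\<^sup>2"
      using \<open>v \<noteq> 0\<close> by simp
    then show ?thesis
      using \<open>t = sqrt k\<close> \<open>0 \<le> L\<close> by (simp add: real_le_lsqrt)
  qed
  moreover have "singular_values M \<noteq> {}"
    using norm_bound_attained by blast
  ultimately show "sigma_max M \<le> L"
    unfolding sigma_max_def by (intro Max.boundedI finite_singular_values)
qed

section \<open>Norm-preserving symmetric extension\<close>

text \<open>Supplies the \<open>P\<close> that plays the role of the pseudoinverse of
  \<open>K\<close> in Krein's formula.\<close>

lemma generalized_inverse: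
  fixes f :: "'a::euclidean_space \<Rightarrow> 'b::euclidean_space"
  assumes "linear f"
  obtains g where "linear g" "\<And>x. f (g (f x)) = f x"
proof -
  have "range f \<subseteq> f ` UNIV" by simp
  then obtain g where "linear g" "\<forall>y\<in>range f. f (g y) = y"
    using linear_exists_right_inverse_on[OF assms subspace_UNIV] by blast
  then show ?thesis
    by (intro that) auto
qed

text \<open>The partial operator is given by the parametrization \<open>X a \<mapsto> Y a\<close>;
  it is well defined because \<open>bound\<close> forces \<open>Y a = 0\<close> whenever
  \<open>X a = 0\<close>.\<close>

lemma symmetric_extension:
  fixes X Y :: "'p::euclidean_space \<Rightarrow> 'h::euclidean_space"
  assumes "linear X" "linear Y" "0 \<le> L"
    and sym: "\<And>a b. X a \<bullet> Y b = Y a \<bullet> X b"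
    and bound: "\<And>a. norm (Y a) \<le> L * norm (X a)"
  obtains H where "linear H" "\<And>h k. H h \<bullet> k = h \<bullet> H k"
    "\<And>h. norm (H h) \<le> L * norm h" "\<And>a. H (X a) = Y a"
proof -
  define W where "W a = Y a + L *\<^sub>R X a" for a
  have "linear W"
    unfolding W_def[abs_def] using assms(1,2) by (intro linear_compose_add linear_compose_scale_right)
  define K where "K a = adjoint X (W a)" for a
  have "linear K"
    using linear_compose[OF \<open>linear W\<close> adjoint_linear[OF \<open>linear X\<close>]]
    by (simp add: K_def[abs_def] comp_def)
  have inner_K: "a \<bullet> K b = X a \<bullet> W b" for a b
    by (simp add: K_def adjoint_works[OF \<open>linear X\<close>])
  have K_sym: "a \<bullet> K b = K a \<bullet> b" for a b
    using sym[of a b]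
    by (simp add: inner_K inner_commute[of "K a"] W_def inner_add_right inner_commute)
  \<comment> \<open>Expanding \<open>|Y a + L X a|^2\<close> and replacing \<open>|Y a|^2\<close> by
    \<open>L^2 |X a|^2\<close> gives exactly the right-hand side.\<close>
  have W_bound: "(norm (W a))\<^sup>2 \<le> 2 * L * (a \<bullet> K a)" for a
  proof -
    have "Y a \<bullet> Y a \<le> L * (L * (X a \<bullet> X a))"
      using power_mono[OF bound[of a], of 2]
      by (simp add: power_mult_distrib power2_norm_eq_inner) (simp add: power2_eq_square)
    then show ?thesis
      unfolding inner_K W_def power2_norm_eq_inner
      by (simp add: inner_add_left inner_add_right inner_commute algebra_simps)
  qed
  \<comment> \<open>By \<open>W_bound\<close> the kernel of \<open>K\<close> lies in that of
    \<open>W\<close>, so \<open>W\<close> factors through \<open>K\<close>.\<close>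
  have W_cong: "W a = W b" if "K a = K b" for a b
    using W_bound[of "a - b"] that
    by (simp add: linear_diff[OF \<open>linear K\<close>] linear_diff[OF \<open>linear W\<close>])
  obtain P where "linear P" and P: "\<And>a. K (P (K a)) = K a"
    using generalized_inverse[OF \<open>linear K\<close>] by blast
  \<comment> \<open>\<open>b h\<close> is a linearly chosen solution of
    \<open>K (b h) = adjoint W h\<close>; \<open>K_b\<close> states this equation in weak
    form.\<close>
  define b where "b h = adjoint P (adjoint W h)" for h
  have "linear b"
    using linear_compose[OF adjoint_linear[OF \<open>linear W\<close>] adjoint_linear[OF \<open>linear P\<close>]]
    by (simp add: b_def[abs_def] comp_def)
  have K_b: "a \<bullet> K (b h) = W a \<bullet> h" for a h
  proof -
    have "a \<bullet> K (b h) = W (P (K a)) \<bullet> h"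
      by (simp add: K_sym b_def adjoint_works \<open>linear P\<close> \<open>linear W\<close>)
    also have "W (P (K a)) = W a"
      by (rule W_cong) (rule P)
    finally show ?thesis .
  qed
  define G where "G h = W (b h)" for h
  have inner_G: "G h \<bullet> k = b h \<bullet> K (b k)" for h k
    by (simp add: G_def K_b)
  have G_X: "G (X a) = W a" for a
    unfolding G_def
  proof (rule W_cong)
    \<comment> \<open>Both sides equal \<open>adjoint W (X a)\<close>, since the symmetry of
      \<open>K\<close> turns \<open>K = X^T W\<close> into \<open>K = W^T X\<close>.\<close>
    show "K (b (X a)) = K a"
      by (rule vector_eq_rdot[THEN iffD1])
        (metis K_b inner_K inner_commute K_sym)
  qed
  define H where "H h = G h - L *\<^sub>R h" for h
  show ?thesis
  proof
    show "linear H"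
      unfolding H_def[abs_def] G_def
      using linear_compose[OF \<open>linear b\<close> \<open>linear W\<close>]
      by (intro linear_compose_sub linear_scaleR) (simp add: comp_def)
    show "H h \<bullet> k = h \<bullet> H k" for h k
      using inner_G[of h k] inner_G[of k h] K_sym[of "b h" "b k"]
      by (simp add: H_def inner_diff_left inner_diff_right inner_commute)
    show "norm (H h) \<le> L * norm h" for h
    proof (rule power2_le_imp_le)
      \<comment> \<open>This cancels the cross term in \<open>|G h - L h|^2\<close> and leaves at
        most \<open>L^2 |h|^2\<close>.\<close>
      have "(norm (G h))\<^sup>2 \<le> 2 * L * (G h \<bullet> h)"
        unfolding inner_G using W_bound[of "b h"] by (simp add: G_def)
      then show "(norm (H h))\<^sup>2 \<le> (L * norm h)\<^sup>2"
        unfolding H_def power_mult_distrib power2_norm_eq_inner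
        by (simp add: inner_diff_left inner_diff_right inner_commute power2_eq_square[of L]
            algebra_simps)
    qed (use \<open>0 \<le> L\<close> in simp)
    show "H (X a) = Y a" for a
      by (simp add: H_def G_X W_def)
  qed
qed

section \<open>Interpolation\<close>

lemma loewner_le_gram_iff:
  fixes X :: "real ^ 'p ^ 'n" and Y :: "real ^ 'p ^ 'm"
  assumes "0 \<le> L"
  shows "transpose Y ** Y \<preceq> L\<^sup>2 *\<^sub>R (transpose X ** X) \<longleftrightarrow>
    (\<forall>a. norm (Y *v a) \<le> L * norm (X *v a))"
proof -
  have "transpose (L\<^sup>2 *\<^sub>R (transpose X ** X) - transpose Y ** Y) =
      L\<^sup>2 *\<^sub>R (transpose X ** X) - transpose Y ** Y"
    by (simp add: vec_eq_iff transpose_def matrix_matrix_mult_def mult.commute)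
  moreover have "a \<bullet> ((L\<^sup>2 *\<^sub>R (transpose X ** X) - transpose Y ** Y) *v a) =
      (L * norm (X *v a))\<^sup>2 - (norm (Y *v a))\<^sup>2" for a
    by (simp add: matrix_vector_mult_diff_rdistrib inner_diff_right inner_gram_mult
        scaleR_matrix_vector_assoc[symmetric] power_mult_distrib power2_norm_eq_inner)
  ultimately show ?thesis
    using \<open>0 \<le> L\<close>
    by (simp add: loewner_le_def pos_semidef_def symmetric_matrix_def abs_le_square_iff[symmetric])
qed

lemma matrix_eq_inner:
  fixes A B :: "real ^ 'n ^ 'm"
  shows "A = B \<longleftrightarrow> (\<forall>x y. x \<bullet> (A *v y) = x \<bullet> (B *v y))"
  by (metis matrix_eq vector_eq_ldot)

lemma interpolation_conditions_iff:
  assumes "0 \<le> L"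
  shows "interpolation_conditions L X Y U V \<longleftrightarrow>
    (\<forall>a b. (X *v a) \<bullet> (V *v b) = (Y *v a) \<bullet> (U *v b)) \<and>
    (\<forall>a. norm (Y *v a) \<le> L * norm (X *v a)) \<and> (\<forall>b. norm (V *v b) \<le> L * norm (U *v b))"
  unfolding interpolation_conditions_def matrix_eq_inner inner_gram_mult
    loewner_le_gram_iff[OF assms] ..

lemma inner_transpose_mult:
  fixes M :: "real ^ 'n ^ 'm"
  shows "x \<bullet> (transpose M *v u) = (M *v x) \<bullet> u"
  by (metis dot_lmul_matrix inner_commute transpose_matrix_vector)

text \<open>Testing the bound on \<open>M\<close> at \<open>w = transpose M *v u\<close> gives
  \<open>|w|^2 \<le> L |w| |u|\<close>, and one factor \<open>|w|\<close> cancels.\<close>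

lemma norm_transpose_le:
  fixes M :: "real ^ 'n ^ 'm"
  assumes "\<And>x. norm (M *v x) \<le> L * norm x"
  shows "norm (transpose M *v u) \<le> L * norm u"
proof (cases "transpose M *v u = 0")
  case True
  \<comment> \<open>The sign of \<open>L\<close> is read off from the bound at a unit
    vector.\<close>
  have "0 \<le> L * norm (axis undefined 1 :: real ^ 'n)"
    using assms norm_ge_zero order_trans by blast
  then show ?thesis
    using True by simp
next
  case False
  define w where "w = transpose M *v u"
  have "norm w * norm w = (M *v w) \<bullet> u"
    unfolding w_def power2_eq_square[symmetric] power2_norm_eq_inner
    by (rule inner_transpose_mult)
  also have "\<dots> \<le> norm (M *v w) * norm u"
    by (rule norm_cauchy_schwarz)
  also have "\<dots> \<le> L * norm w * norm u"
    using assms by (simp add: mult_right_mono)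
  finally have "norm w * norm w \<le> norm w * (L * norm u)"
    by (simp add: ac_simps)
  then show ?thesis
    using False by (simp add: w_def)
qed

lemma interpolates_iff:
  assumes "0 \<le> L"
  shows "interpolates L X Y U V M \<longleftrightarrow>
    (\<forall>x. norm (M *v x) \<le> L * norm x) \<and> Y = M ** X \<and> V = transpose M ** U"
  by (simp add: interpolates_def sigma_max_le_iff[OF assms])

lemma interpolates_imp_conditions:
  assumes "0 \<le> L" "interpolates L X Y U V M"
  shows "interpolation_conditions L X Y U V"
proof -
  have "\<And>x. norm (M *v x) \<le> L * norm x" "Y = M ** X" "V = transpose M ** U"
    using assms by (auto simp: interpolates_iff)
  then show ?thesis
    using norm_transpose_le[of M L]
    by (simp add: interpolation_conditions_iff[OF \<open>0 \<le> L\<close>] inner_transpose_mult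
        del: transpose_matrix_vector flip: matrix_vector_mul_assoc)
qed

text \<open>The three conditions say that \<open>Z c \<mapsto> T c\<close> is a symmetric partial
  operator on the product space with bound \<open>L\<close>. \<open>M\<close> is an off-diagonal
  block of its extension \<open>H\<close>.\<close>

lemma conditions_imp_interpolates:
  fixes X :: "real ^ 'p ^ 'n" and Y :: "real ^ 'p ^ 'm"
    and U :: "real ^ 'q ^ 'm" and V :: "real ^ 'q ^ 'n"
  assumes "0 \<le> L" "interpolation_conditions L X Y U V"
  shows "\<exists>M. interpolates L X Y U V M"
proof -
  have orth: "(X *v a) \<bullet> (V *v b) = (Y *v a) \<bullet> (U *v b)"
    and Y_le: "norm (Y *v a) \<le> L * norm (X *v a)"
    and V_le: "norm (V *v b) \<le> L * norm (U *v b)" for a b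
    using assms by (auto simp: interpolation_conditions_iff)
  define Z :: "(real ^ 'p) \<times> (real ^ 'q) \<Rightarrow> (real ^ 'n) \<times> (real ^ 'm)"
    where "Z c = (X *v fst c, U *v snd c)" for c
  define T :: "(real ^ 'p) \<times> (real ^ 'q) \<Rightarrow> (real ^ 'n) \<times> (real ^ 'm)"
    where "T c = (V *v snd c, Y *v fst c)" for c
  have "linear Z" "linear T"
    unfolding Z_def T_def
    by (auto intro!: linearI simp: matrix_vector_right_distrib matrix_vector_mult_scaleR)
  moreover have "Z c \<bullet> T d = T c \<bullet> Z d" for c d
    using orth[of "fst c" "snd d"] orth[of "fst d" "snd c"]
    by (simp add: Z_def T_def inner_commute)
  moreover have "norm (T c) \<le> L * norm (Z c)" for c
  proof (rule power2_le_imp_le)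
    show "(norm (T c))\<^sup>2 \<le> (L * norm (Z c))\<^sup>2"
      using power_mono[OF Y_le[of "fst c"], of 2] power_mono[OF V_le[of "snd c"], of 2]
      by (simp add: Z_def T_def norm_Pair power_mult_distrib algebra_simps)
  qed (use \<open>0 \<le> L\<close> in simp)
  ultimately obtain H where "linear H" and H_sym: "\<And>h k. H h \<bullet> k = h \<bullet> H k"
    and H_le: "\<And>h. norm (H h) \<le> L * norm h" and H_Z: "\<And>c. H (Z c) = T c"
    using symmetric_extension[of Z T L] \<open>0 \<le> L\<close> by metis
  interpret H: linear H by fact
  define M where "M = matrix (\<lambda>x. snd (H (x, 0)))"
  have lin: "linear (\<lambda>x. snd (H (x, 0)))"
  proof (rule linearI)
    show "snd (H (x + y, 0)) = snd (H (x, 0)) + snd (H (y, 0))" for x y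
      using H.add[of "(x, 0)" "(y, 0)"] by simp
    show "snd (H (r *\<^sub>R x, 0)) = r *\<^sub>R snd (H (x, 0))" for r x
      using H.scale[of r "(x, 0)"] by simp
  qed
  have M: "M *v x = snd (H (x, 0))" for x
    unfolding M_def by (simp add: matrix_vector_mul(2)[OF lin])
  \<comment> \<open>Symmetry of \<open>H\<close> makes its two off-diagonal blocks transposes of
    each other.\<close>
  have Mt: "transpose M *v u = fst (H (0, u))" for u
  proof (rule vector_eq_ldot[THEN iffD1], rule allI)
    fix x
    have "x \<bullet> (transpose M *v u) = (M *v x) \<bullet> u"
      by (rule inner_transpose_mult)
    also have "\<dots> = x \<bullet> fst (H (0, u))"
      using H_sym[of "(x, 0)" "(0, u)"] by (simp add: M inner_prod_def)
    finally show "x \<bullet> (transpose M *v u) = x \<bullet> fst (H (0, u))" .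
  qed
  \<comment> \<open>Passing to a block does not increase the norm, even if \<open>H\<close> has
    nonzero diagonal blocks.\<close>
  have "norm (M *v x) \<le> L * norm x" for x
    using norm_snd_le[of "snd (H (x, 0))" "fst (H (x, 0))"] H_le[of "(x, 0)"]
    by (simp add: M norm_Pair)
  \<comment> \<open>For \<open>c = (a, 0)\<close> the extension property reads
    \<open>H (X a, 0) = (0, Y a)\<close>.\<close>
  moreover have "Y = M ** X"
    using H_Z[of "(_, 0)"]
    by (simp add: matrix_eq M Z_def T_def flip: matrix_vector_mul_assoc)
  moreover have "V = transpose M ** U"
    using H_Z[of "(0, _)"]
    by (simp add: matrix_eq Mt Z_def T_def del: transpose_matrix_vector
        flip: matrix_vector_mul_assoc)
  ultimately show ?thesis
    using \<open>0 \<le> L\<close> by (auto simp: interpolates_iff)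
qed

text \<open>With \<open>s = 1\<close> or \<open>s = -1\<close>, the matrix
  \<open>s *\<^sub>R transpose M\<close> also sends \<open>X\<close> to \<open>Y\<close> and obeys
  the same bound. Both properties survive averaging, and the average is fixed under
  \<open>M \<mapsto> s *\<^sub>R transpose M\<close>.\<close>

lemma average_transpose_interpolates:
  assumes "0 \<le> L" "\<bar>s\<bar> = 1" "interpolates L X Y X (s *\<^sub>R Y) M"
  defines "M' \<equiv> (1/2) *\<^sub>R (M + s *\<^sub>R transpose M)"
  shows "interpolates L X Y X (s *\<^sub>R Y) M'" "transpose M' = s *\<^sub>R M'"
proof -
  have M: "\<And>x. norm (M *v x) \<le> L * norm x" "M ** X = Y" "transpose M ** X = s *\<^sub>R Y"
    using assms by (auto simp: interpolates_iff)
  have ss: "s * s = 1"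
    using assms(2) by (metis abs_mult_self_eq mult_1)
  show tr: "transpose M' = s *\<^sub>R M'"
    unfolding M'_def using ss by (simp add: vec_eq_iff transpose_def algebra_simps)
  have M'_mult: "M' *v x = (1/2) *\<^sub>R (M *v x + s *\<^sub>R (transpose M *v x))" for x
    by (simp add: M'_def matrix_vector_mult_add_rdistrib flip: scaleR_matrix_vector_assoc)
  have "norm (M *v x + s *\<^sub>R (transpose M *v x)) \<le> L * norm x + L * norm x" for x
    using norm_transpose_le[OF M(1)] assms(2) by (intro norm_triangle_mono M(1)) simp
  then have "norm (M' *v x) \<le> L * norm x" for x
    by (simp add: M'_mult mult.commute)
  moreover have "Y = M' ** X"
  proof (rule matrix_eq[THEN iffD2], rule allI)
    fix a
    have "M *v (X *v a) = Y *v a" "transpose M *v (X *v a) = s *\<^sub>R (Y *v a)"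
      using M(2,3) by (simp_all add: matrix_vector_mul_assoc scaleR_matrix_vector_assoc
          del: transpose_matrix_vector)
    then show "Y *v a = (M' ** X) *v a"
      using ss by (simp add: M'_mult del: transpose_matrix_vector flip: matrix_vector_mul_assoc
          scaleR_2)
  qed
  \<comment> \<open>The remaining equation follows from \<open>tr\<close>:
    \<open>transpose M' ** X = s *\<^sub>R (M' ** X)\<close>.\<close>
  ultimately show "interpolates L X Y X (s *\<^sub>R Y) M'"
    using \<open>0 \<le> L\<close> by (simp add: interpolates_iff tr flip: scalar_matrix_assoc)
qed

text \<open>The primed matrices have their own types because \<open>U = X\<close> and
  \<open>V = Y\<close> force the dimensions to coincide, which is here an identification of
  types.\<close>

theorem theorem3p1:
  fixes L :: real
    and X :: "real ^ 'N1 ^ 'n" and Y :: "real ^ 'N1 ^ 'm"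
    and U :: "real ^ 'N2 ^ 'm" and V :: "real ^ 'N2 ^ 'n"
    and X' Y' U' V' :: "real ^ 'N ^ 'd"
  assumes "L \<ge> 0"
  shows "((\<exists>M :: real ^ 'n ^ 'm. interpolates L X Y U V M) \<longleftrightarrow> interpolation_conditions L X Y U V)
    \<and> (U' = X' \<and> V' = Y' \<and> interpolation_conditions L X' Y' U' V' \<longrightarrow>
        (\<exists>M :: real ^ 'd ^ 'd. interpolates L X' Y' U' V' M \<and> symmetric_matrix M))
    \<and> (U' = X' \<and> V' = - Y' \<and> interpolation_conditions L X' Y' U' V' \<longrightarrow>
        (\<exists>M :: real ^ 'd ^ 'd. interpolates L X' Y' U' V' M \<and> skew_symmetric_matrix M))"
proof (intro conjI impI; (elim conjE)?)
  show "(\<exists>M. interpolates L X Y U V M) \<longleftrightarrow> interpolation_conditions L X Y U V"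
    using assms interpolates_imp_conditions conditions_imp_interpolates by blast
next
  assume *: "U' = X'" "V' = Y'" "interpolation_conditions L X' Y' U' V'"
  \<comment> \<open>The factor \<open>1\<close> exhibits \<open>V'\<close> in the form
    \<open>s *\<^sub>R Y'\<close> required for averaging; the skew case takes
    \<open>s = -1\<close>.\<close>
  then obtain M where "interpolates L X' Y' X' (1 *\<^sub>R Y') M"
    using conditions_imp_interpolates[OF assms, of X' Y' X' Y'] by auto
  from average_transpose_interpolates[OF assms _ this]
  show "\<exists>M. interpolates L X' Y' U' V' M \<and> symmetric_matrix M"
    using * by (auto simp: symmetric_matrix_def)
next
  assume *: "U' = X'" "V' = - Y'" "interpolation_conditions L X' Y' U' V'"
  then obtain M where "interpolates L X' Y' X' ((- 1) *\<^sub>R Y') M"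
    using conditions_imp_interpolates[OF assms, of X' Y' X' "- Y'"] by auto
  from average_transpose_interpolates[OF assms _ this]
  show "\<exists>M. interpolates L X' Y' U' V' M \<and> skew_symmetric_matrix M"
    using * by (auto simp: skew_symmetric_matrix_def)
qed

end
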